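(* Let $G=\bigvee_{n\ge 1}G_n$ be the wedge of the graphs $G_n$, let $\Gamma$ be the group generated by the oriented edges of $G$ with all loops of $G$ as relations, and let $d_S$ be the word metric on $\Gamma$ with respect to the set $S$ of edges of $G$ (all as defined in the context). Then $(\Gamma,d_S)$ does not admit a coarsely uniform embedding into a Hilbert space.
   Context: A map $f:X\to Y$ between metric spaces is a coarsely uniform embedding if there are functions $\rho_1,\rho_2:[0,\infty)\to[0,\infty)$ with $\lim_{t\to\infty}\rho_i(t)=\infty$ for $i=1,2$ such that $\rho_1(d_X(x,x'))\le d_Y(f(x),f(x'))\le\rho_2(d_X(x,x'))$ for all $x,x'\in X$. For an integer $n\ge 1$ let $N_n=\{0,1,\dots,2^{n+1}-1\}$ with the cyclic metric $|x-y|_n:=\min\{|x-y|,\,2^{n+1}-|x-y|\}$ (distance modulo $2^{n+1}$). Let $M_n=(N_n)^{2n^n}$ be the product of $2n^n$ copies of $N_n$ with the metric $d(a,b)=\max_i|a_i-b_i|_n$. Let $G_n$ be the (connected) graph whose vertices are the points of $M_n$, two vertices $a,b$ being joined by an edge if and only if $d(a,b)=1$. Let $G$ be the wedge of all the graphs $G_n$, $n\ge1$, i.e. the graph obtained from their disjoint union by choosing a base vertex in each $G_n$ and identifying all base vertices to one point. Fix an orientation on every edge of $G$. The group $\Gamma$ is given by the presentation whose generators are the (oriented) edges of $G$ and whose relations are all loops: for every closed edge path in $G$ traversing edges $e_1,\dots,e_k$ with signs $\epsilon_i\in\{1,-1\}$ ($\epsilon_i=1$ if $e_i$ is traversed along its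 orientation, $-1$ otherwise), one has the relation $e_1^{\epsilon_1}\cdots e_k^{\epsilon_k}=1$. For the generating set $S$ consisting of the edges of $G$, the word metric is $d_S(x,y)=\|x^{-1}y\|_S$, where $\|w\|_S$ is the minimal length of a word in elements of $S$ and their inverses representing $w$. *)

theory Defs
  imports "HOL-Analysis.Analysis" "HOL-Algebra.Group" "Graph_Theory.Pair_Digraph"
begin

definition coarsely_uniform_embedding ::
  "'a set \<Rightarrow> ('a \<Rightarrow> 'a \<Rightarrow> real) \<Rightarrow> 'b set \<Rightarrow> ('b \<Rightarrow> 'b \<Rightarrow> real) \<Rightarrow> ('a \<Rightarrow> 'b) \<Rightarrow> bool"
  where
  "coarsely_uniform_embedding X dX Y dY f \<longleftrightarrow>
     f \<in> X \<rightarrow> Y \<and>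
     (\<exists>\<rho>1 \<rho>2 :: real \<Rightarrow> real.
        (\<forall>t\<ge>0. \<rho>1 t \<ge> 0 \<and> \<rho>2 t \<ge> 0) \<and>
        filterlim \<rho>1 at_top at_top \<and> filterlim \<rho>2 at_top at_top \<and>
        (\<forall>x\<in>X. \<forall>x'\<in>X. \<rho>1 (dX x x') \<le> dY (f x) (f x') \<and> dY (f x) (f x') \<le> \<rho>2 (dX x x')))"

definition cyc_points :: "nat \<Rightarrow> int set" where
  "cyc_points n = {0 ..< 2 ^ (n + 1)}"

definition cyc_dist :: "nat \<Rightarrow> int \<Rightarrow> int \<Rightarrow> int" where
  "cyc_dist n x y = min \<bar>x - y\<bar> (2 ^ (n + 1) - \<bar>x - y\<bar>)"

definition torus_points :: "nat \<Rightarrow> (nat \<Rightarrow> int) set" where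
  "torus_points n = (\<Pi>\<^sub>E i\<in>{..<2 * n ^ n}. cyc_points n)"

definition torus_dist :: "nat \<Rightarrow> (nat \<Rightarrow> int) \<Rightarrow> (nat \<Rightarrow> int) \<Rightarrow> int" where
  "torus_dist n a b = Max ((\<lambda>i. cyc_dist n (a i) (b i)) ` {..<2 * n ^ n})"

text \<open>
  Simple undirected graphs are represented by symmetric digraphs: every edge contributes its two
  arcs, one for each direction of traversal.
\<close>

definition torus_graph :: "nat \<Rightarrow> (nat \<Rightarrow> int) pair_pre_digraph" where
  "torus_graph n =
     \<lparr> pverts = torus_points n,
       parcs = {(a, b). a \<in> torus_points n \<and> b \<in> torus_points n \<and> torus_dist n a b = 1} \<rparr>"

text \<open>
  The quotient of the disjoint union of the vertex sets that identifies all base vertices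
  \<open>b i\<close>, with the images of all arcs.
\<close>

definition wedge_rel :: "'i set \<Rightarrow> ('i \<Rightarrow> 'v pair_pre_digraph) \<Rightarrow> ('i \<Rightarrow> 'v) \<Rightarrow> ('i \<times> 'v) rel" where
  "wedge_rel I H b =
     {((i, x), (j, y)). i \<in> I \<and> x \<in> pverts (H i) \<and> j \<in> I \<and> y \<in> pverts (H j) \<and>
        ((i, x) = (j, y) \<or> x = b i \<and> y = b j)}"

definition wedge ::
  "'i set \<Rightarrow> ('i \<Rightarrow> 'v pair_pre_digraph) \<Rightarrow> ('i \<Rightarrow> 'v) \<Rightarrow> ('i \<times> 'v) set pair_pre_digraph" where
  "wedge I H b =
     \<lparr> pverts = (SIGMA i:I. pverts (H i)) // wedge_rel I H b,
       parcs = {(wedge_rel I H b `` {(i, x)}, wedge_rel I H b `` {(i, y)}) | i x y.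
                  i \<in> I \<and> (x, y) \<in> parcs (H i)} \<rparr>"

lemma equiv_wedge_rel: "equiv (SIGMA i:I. pverts (H i)) (wedge_rel I H b)"
  by (rule equivI) (auto simp: wedge_rel_def refl_on_def sym_def trans_def)

abbreviation torus_wedge :: "(nat \<Rightarrow> nat \<Rightarrow> int) \<Rightarrow> (nat \<times> (nat \<Rightarrow> int)) set pair_pre_digraph" where
  "torus_wedge \<equiv> wedge {1..} torus_graph"

text \<open>A letter \<open>(x, True)\<close> stands for the generator \<open>x\<close> and \<open>(x, False)\<close> for its inverse.\<close>

type_synonym 'g letter = "'g \<times> bool"

definition words_over :: "'g set \<Rightarrow> 'g letter list set" where
  "words_over X = lists (X \<times> UNIV)"

lemma words_over_simps [simp]:
  "[] \<in> words_over X"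
  "l # w \<in> words_over X \<longleftrightarrow> fst l \<in> X \<and> w \<in> words_over X"
  "v @ w \<in> words_over X \<longleftrightarrow> v \<in> words_over X \<and> w \<in> words_over X"
  by (cases l; auto simp: words_over_def)+

lemma words_over_rev_inverse:
  "w \<in> words_over X \<Longrightarrow> map (\<lambda>(x, e). (x, \<not> e)) (rev w) \<in> words_over X"
  by (induction w) (auto simp: split_beta)

inductive_set presentation_rel :: "'g set \<Rightarrow> 'g letter list set \<Rightarrow> 'g letter list rel"
  for X :: "'g set" and R :: "'g letter list set" where
  refl: "w \<in> words_over X \<Longrightarrow> (w, w) \<in> presentation_rel X R"
| sym: "(v, w) \<in> presentation_rel X R \<Longrightarrow> (w, v) \<in> presentation_rel X R"
| trans: "\<lbrakk>(u, v) \<in> presentation_rel X R; (v, w) \<in> presentation_rel X R\<rbrakk>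
     \<Longrightarrow> (u, w) \<in> presentation_rel X R"
| cancel: "\<lbrakk>u \<in> words_over X; v \<in> words_over X; x \<in> X\<rbrakk>
     \<Longrightarrow> (u @ [(x, e), (x, \<not> e)] @ v, u @ v) \<in> presentation_rel X R"
| relator: "\<lbrakk>u \<in> words_over X; v \<in> words_over X; r \<in> R \<inter> words_over X\<rbrakk>
     \<Longrightarrow> (u @ r @ v, u @ v) \<in> presentation_rel X R"

definition presented_group :: "'g set \<Rightarrow> 'g letter list set \<Rightarrow> 'g letter list set monoid" where
  "presented_group X R =
     \<lparr> carrier = words_over X // presentation_rel X R,
       mult = (\<lambda>A B. \<Union>u\<in>A. \<Union>v\<in>B. presentation_rel X R `` {u @ v}),
       one = presentation_rel X R `` {[]} \<rparr>"

definition presented_gen :: "'g set \<Rightarrow> 'g letter list set \<Rightarrow> 'g \<Rightarrow> 'g letter list set" where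
  "presented_gen X R x = presentation_rel X R `` {[(x, True)]}"

lemma presentation_rel_words:
  "(v, w) \<in> presentation_rel X R \<Longrightarrow> v \<in> words_over X \<and> w \<in> words_over X"
  by (induction rule: presentation_rel.induct) auto

lemma equiv_presentation_rel: "equiv (words_over X) (presentation_rel X R)"
proof (rule equivI)
  show "presentation_rel X R \<subseteq> words_over X \<times> words_over X"
    by (auto dest: presentation_rel_words)
  show "refl_on (words_over X) (presentation_rel X R)"
    by (auto simp: refl_on_def intro: presentation_rel.refl)
  show "sym (presentation_rel X R)"
    by (auto simp: sym_def intro: presentation_rel.sym)
  show "trans (presentation_rel X R)"
    by (auto simp: trans_def intro: presentation_rel.trans)
qed

lemma presentation_rel_context:
  assumes "(v, w) \<in> presentation_rel X R" "s \<in> words_over X" "t \<in> words_over X"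
  shows "(s @ v @ t, s @ w @ t) \<in> presentation_rel X R"
  using assms
proof (induction rule: presentation_rel.induct)
  case (cancel u v x e)
  then show ?case using presentation_rel.cancel[of "s @ u" X "v @ t" x e R] by auto
next
  case (relator u v r)
  then show ?case using presentation_rel.relator[of "s @ u" X "v @ t" r R] by auto
qed (auto intro: presentation_rel.intros)

lemma presentation_rel_append:
  assumes "(u, u') \<in> presentation_rel X R" "(v, v') \<in> presentation_rel X R"
  shows "(u @ v, u' @ v') \<in> presentation_rel X R"
  using presentation_rel_context[OF assms(1), of "[]" v]
    presentation_rel_context[OF assms(2), of u' "[]"]
    presentation_rel_words[OF assms(1)] presentation_rel_words[OF assms(2)]
  by (auto intro: presentation_rel.trans)

lemma presented_mult_classes:
  assumes "u \<in> words_over X" "v \<in> words_over X"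
  shows "presentation_rel X R `` {u} \<otimes>\<^bsub>presented_group X R\<^esub> presentation_rel X R `` {v}
    = presentation_rel X R `` {u @ v}"
proof -
  have "presentation_rel X R `` {u' @ v'} = presentation_rel X R `` {u @ v}"
    if "(u, u') \<in> presentation_rel X R" "(v, v') \<in> presentation_rel X R" for u' v'
    using presentation_rel_append[OF that] equiv_class_eq[OF equiv_presentation_rel] by metis
  moreover have "(u, u) \<in> presentation_rel X R" "(v, v) \<in> presentation_rel X R"
    using assms by (auto intro: presentation_rel.refl)
  ultimately show ?thesis
    unfolding presented_group_def monoid.simps by fast
qed

lemma presentation_rel_inverse:
  assumes "w \<in> words_over X"
  shows "(map (\<lambda>(x, e). (x, \<not> e)) (rev w) @ w, []) \<in> presentation_rel X R"
  using assms
proof (induction w)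
  case Nil
  then show ?case by (auto intro: presentation_rel.refl)
next
  case (Cons l w)
  obtain x e where l: "l = (x, e)" by fastforce
  let ?u = "map (\<lambda>(x, e). (x, \<not> e)) (rev w)"
  have u: "?u \<in> words_over X" using Cons.prems by (simp add: words_over_rev_inverse)
  have "(?u @ [(x, \<not> e), (x, \<not> \<not> e)] @ w, ?u @ w) \<in> presentation_rel X R"
    using Cons.prems l u by (intro presentation_rel.cancel) auto
  moreover have "(?u @ w, []) \<in> presentation_rel X R" using Cons by auto
  ultimately show ?case using l by (auto intro: presentation_rel.trans)
qed

lemma group_presented_group: "group (presented_group X R)"
proof (rule groupI)
  let ?G = "presented_group X R" and ?c = "\<lambda>w. presentation_rel X R `` {w}"
  have carr: "\<exists>w\<in>words_over X. x = ?c w" if "x \<in> carrier ?G" for x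
    using that by (auto simp: presented_group_def elim: quotientE)
  have cls: "?c w \<in> carrier ?G" if "w \<in> words_over X" for w
    using that unfolding presented_group_def by (simp add: quotientI)
  have one: "\<one>\<^bsub>?G\<^esub> = ?c []" by (simp add: presented_group_def)
  show "\<one>\<^bsub>?G\<^esub> \<in> carrier ?G" using cls one by simp
  show "x \<otimes>\<^bsub>?G\<^esub> y \<in> carrier ?G" if "x \<in> carrier ?G" "y \<in> carrier ?G" for x y
    using carr[OF that(1)] carr[OF that(2)] by (auto simp: presented_mult_classes intro!: cls)
  show "x \<otimes>\<^bsub>?G\<^esub> y \<otimes>\<^bsub>?G\<^esub> z = x \<otimes>\<^bsub>?G\<^esub> (y \<otimes>\<^bsub>?G\<^esub> z)"
    if "x \<in> carrier ?G" "y \<in> carrier ?G" "z \<in> carrier ?G" for x y z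
    using carr[OF that(1)] carr[OF that(2)] carr[OF that(3)]
    by (auto simp: presented_mult_classes)
  show "\<one>\<^bsub>?G\<^esub> \<otimes>\<^bsub>?G\<^esub> x = x" if "x \<in> carrier ?G" for x
    using carr[OF that] by (auto simp: one presented_mult_classes)
  show "\<exists>y\<in>carrier ?G. y \<otimes>\<^bsub>?G\<^esub> x = \<one>\<^bsub>?G\<^esub>" if "x \<in> carrier ?G" for x
  proof -
    obtain w where w: "w \<in> words_over X" "x = ?c w"
      using carr[OF \<open>x \<in> carrier ?G\<close>] by blast
    let ?u = "map (\<lambda>(x, e). (x, \<not> e)) (rev w)"
    have u: "?u \<in> words_over X" by (rule words_over_rev_inverse[OF w(1)])
    have "?c ?u \<otimes>\<^bsub>?G\<^esub> x = \<one>\<^bsub>?G\<^esub>"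
      using presentation_rel_inverse[OF w(1), of R] equiv_class_eq[OF equiv_presentation_rel]
      by (metis one presented_mult_classes u w)
    then show ?thesis using cls[OF u] by blast
  qed
qed

definition word_norm :: "('a, 'm) monoid_scheme \<Rightarrow> 'a set \<Rightarrow> 'a \<Rightarrow> nat" where
  "word_norm \<Gamma> S x =
     (LEAST n. \<exists>ws. length ws = n \<and> set ws \<subseteq> S \<union> m_inv \<Gamma> ` S \<and> foldr (mult \<Gamma>) ws \<one>\<^bsub>\<Gamma>\<^esub> = x)"

definition word_dist :: "('a, 'm) monoid_scheme \<Rightarrow> 'a set \<Rightarrow> 'a \<Rightarrow> 'a \<Rightarrow> real" where
  "word_dist \<Gamma> S x y = real (word_norm \<Gamma> S (inv\<^bsub>\<Gamma>\<^esub> x \<otimes>\<^bsub>\<Gamma>\<^esub> y))"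

definition orientation :: "'v pair_pre_digraph \<Rightarrow> 'v rel \<Rightarrow> bool" where
  "orientation G A \<longleftrightarrow>
     A \<subseteq> parcs G \<and> (\<forall>(u, v) \<in> parcs G. ((u, v) \<in> A) \<noteq> ((v, u) \<in> A))"

definition arc_letter :: "'v rel \<Rightarrow> 'v \<times> 'v \<Rightarrow> ('v \<times> 'v) letter" where
  "arc_letter A e = (if e \<in> A then (e, True) else (prod.swap e, False))"

definition loop_words :: "'v pair_pre_digraph \<Rightarrow> 'v rel \<Rightarrow> ('v \<times> 'v) letter list set" where
  "loop_words G A = {map (arc_letter A) p | p u. pre_digraph.awalk (with_proj G) u p u}"

lemma loop_words_subset:
  assumes "orientation G A"
  shows "loop_words G A \<subseteq> words_over A"
proof -
  have "fst (arc_letter A e) \<in> A" if "e \<in> parcs G" for e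
    using assms that by (cases e) (auto simp: orientation_def arc_letter_def)
  then have "map (arc_letter A) p \<in> words_over A" if "set p \<subseteq> parcs G" for p
    using that by (induction p) auto
  then show ?thesis
    by (auto simp: loop_words_def pre_digraph.awalk_def)
qed

definition edge_group :: "'v pair_pre_digraph \<Rightarrow> 'v rel \<Rightarrow> ('v \<times> 'v) letter list set monoid" where
  "edge_group G A = presented_group A (loop_words G A)"

definition edge_gens :: "'v pair_pre_digraph \<Rightarrow> 'v rel \<Rightarrow> ('v \<times> 'v) letter list set set" where
  "edge_gens G A = presented_gen A (loop_words G A) ` A"

end

theory Submission
  imports Defs "HOL-Combinatorics.Permutations"
begin

text \<open>
  A coarsely uniform embedding of \<open>\<Gamma>\<close> would embed all the tori \<open>M\<^sub>n\<close> into one Hilbert space with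
  common control functions, and Enflo's averaging argument shows that this is impossible.

  The tori sit isometrically in \<open>\<Gamma>\<close>. Send a vertex of \<open>G\<close> to the class of any walk from the
  base point to it; parallel walks give the same class because their difference is a loop. The
  difference between the elements of adjacent vertices is a generator or its inverse, so edges
  have length at most 1. Conversely, an integer function \<open>\<phi>\<close> on the vertices that changes by
  at most 1 along edges gives a homomorphism from \<open>\<Gamma>\<close> to the integers, \<open>(x, y) \<mapsto> \<phi> y - \<phi> x\<close>, which
  kills all loops and is bounded by the word length. Taking for \<open>\<phi>\<close> the cyclic distance to a
  given point in one coordinate of \<open>M\<^sub>n\<close>, constant on the other tori, shows that distances in
  \<open>M\<^sub>n\<close> are not shortened (\<open>torus_embeds_in_edge_group\<close>).

  In Hilbert space a double \<open>n\<close>-simplex satisfies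
  \<open>\<Sum>|a\<^sub>p - a\<^sub>q|\<^sup>2 + \<Sum>|b\<^sub>p - b\<^sub>q|\<^sup>2 \<le> 2 \<Sum>|a\<^sub>p - b\<^sub>q|\<^sup>2\<close>
  (\<open>double_simplex_inequality\<close>). The torus contains double simplices with all sides
  \<open>a\<^sub>p - a\<^sub>q\<close> and \<open>b\<^sub>p - b\<^sub>q\<close> of length \<open>2\<^bsup>k+1\<^esup>\<close> and all connecting segments of length \<open>2\<^bsup>k\<^esup>\<close>;
  moreover all sides are equivalent under permutation of the coordinates, and so are all
  connecting segments (\<open>double_simplex_in_torus\<close>). Let \<open>E\<^sub>k\<close> be the total squared length of the
  image of a segment of scale \<open>2\<^bsup>k\<^esup>\<close>, summed over all translations and coordinate permutations.
  Summing the inequality over these symmetries gives \<open>(n - 1) E\<^sub>k\<^sub>+\<^sub>1 \<le> n E\<^sub>k\<close>, hence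
  \<open>E\<^sub>n \<le> (1 - 1/n)\<^bsup>-n\<^esup> E\<^sub>0 \<le> 9 E\<^sub>0\<close>. So if edges of \<open>M\<^sub>n\<close> have images of length at most \<open>C\<close>,
  then some pair at distance \<open>2\<^bsup>n\<^esup>\<close> has an image of length at most \<open>3 C\<close>
  (\<open>hilbert_torus_distortion\<close>). As \<open>n\<close> grows, this contradicts the properness of the lower control
  function.
\<close>

section \<open>Double simplices in Hilbert space and on the torus\<close>

lemma sum_sum_norm_diff_sq:
  fixes x y :: "'i \<Rightarrow> 'h :: real_inner"
  shows "(\<Sum>i\<in>I. \<Sum>j\<in>I. (norm (x i - y j))\<^sup>2) =
    real (card I) * (\<Sum>i\<in>I. (norm (x i))\<^sup>2) + real (card I) * (\<Sum>i\<in>I. (norm (y i))\<^sup>2)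
      - 2 * ((\<Sum>i\<in>I. x i) \<bullet> (\<Sum>i\<in>I. y i))"
proof -
  have "(norm (x i - y j))\<^sup>2 = (norm (x i))\<^sup>2 + (norm (y j))\<^sup>2 - 2 * (x i \<bullet> y j)" for i j
    by (simp add: power2_norm_eq_inner inner_diff inner_commute)
  moreover have "(\<Sum>i\<in>I. x i) \<bullet> (\<Sum>i\<in>I. y i) = (\<Sum>i\<in>I. \<Sum>j\<in>I. x i \<bullet> y j)"
    by (simp only: inner_sum_left) (simp only: inner_sum_right)
  ultimately show ?thesis
    by (simp add: sum.distrib sum_subtractf sum_distrib_left)
qed

text \<open>
  The difference of the two sides is \<open>2 |\<Sum>a - \<Sum>b|\<^sup>2\<close>.
\<close>

lemma double_simplex_inequality:
  fixes a b :: "'i \<Rightarrow> 'h :: real_inner"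
  shows "(\<Sum>i\<in>I. \<Sum>j\<in>I. (dist (a i) (a j))\<^sup>2) + (\<Sum>i\<in>I. \<Sum>j\<in>I. (dist (b i) (b j))\<^sup>2)
    \<le> 2 * (\<Sum>i\<in>I. \<Sum>j\<in>I. (dist (a i) (b j))\<^sup>2)"
proof -
  have "0 \<le> ((\<Sum>i\<in>I. a i) - (\<Sum>i\<in>I. b i)) \<bullet> ((\<Sum>i\<in>I. a i) - (\<Sum>i\<in>I. b i))"
    by simp
  then show ?thesis
    unfolding dist_norm sum_sum_norm_diff_sq
    by (simp add: inner_diff inner_commute algebra_simps)
qed

text \<open>
  The projection from integer vectors to the torus. Writing translations of the torus as
  addition in \<open>\<int>\<^sup>N\<close> followed by this projection keeps signs and differences of vectors meaningful.
\<close>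

definition reduce :: "nat \<Rightarrow> (nat \<Rightarrow> int) \<Rightarrow> nat \<Rightarrow> int" where
  "reduce n t = (\<lambda>i\<in>{..<2 * n ^ n}. t i mod 2 ^ (n + 1))"

lemma reduce_cong: "(\<And>i. i < 2 * n ^ n \<Longrightarrow> t i = t' i) \<Longrightarrow> reduce n t = reduce n t'"
  by (auto simp: reduce_def restrict_def fun_eq_iff)

lemma reduce_in_torus [simp]: "reduce n t \<in> torus_points n"
  by (auto simp: reduce_def torus_points_def cyc_points_def)

lemma reduce_torus: "t \<in> torus_points n \<Longrightarrow> reduce n t = t"
  by (auto simp: reduce_def torus_points_def cyc_points_def fun_eq_iff PiE_def Pi_def
      extensional_def)

lemma reduce_reduce_add: "reduce n (\<lambda>i. reduce n t i + v i) = reduce n (\<lambda>i. t i + v i)"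
  by (auto simp: reduce_def fun_eq_iff mod_simps)

lemma finite_torus_points [simp]: "finite (torus_points n)"
  by (auto simp: torus_points_def cyc_points_def intro: finite_PiE)

lemma torus_points_nonempty: "torus_points n \<noteq> {}"
  by (metis empty_iff reduce_in_torus)

text \<open>
  Translations permute the torus.
\<close>

lemma sum_torus_shift:
  "(\<Sum>t\<in>torus_points n. h (reduce n (\<lambda>i. t i + v i))) = (\<Sum>t\<in>torus_points n. h t)"
  by (rule sum.reindex_bij_witness[of _ "\<lambda>t. reduce n (\<lambda>i. t i + - v i)"
        "\<lambda>t. reduce n (\<lambda>i. t i + v i)"])
    (auto simp only: reduce_reduce_add reduce_in_torus reduce_torus add.assoc
      add.right_inverse add.left_inverse add_0_right)

text \<open>
  The total squared displacement of \<open>g\<close> along the vector \<open>w\<close>, over all base points and all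
  rearrangements of the coordinates of \<open>w\<close>. Summing over the full symmetry group makes it
  depend only on how often \<open>w\<close> takes each value.
\<close>

definition shift_energy ::
  "nat \<Rightarrow> ((nat \<Rightarrow> int) \<Rightarrow> 'h :: metric_space) \<Rightarrow> (nat \<Rightarrow> int) \<Rightarrow> real" where
  "shift_energy n g w = (\<Sum>\<sigma> | \<sigma> permutes {..<2 * n ^ n}. \<Sum>t\<in>torus_points n.
     (dist (g (reduce n (\<lambda>i. t i + w (\<sigma> i)))) (g t))\<^sup>2)"

text \<open>
  Translating the base point by \<open>- v\<close> turns a segment from \<open>v\<close> to \<open>u\<close> into a displacement by
  \<open>u - v\<close>.
\<close>

lemma shift_energy_diff:
  "(\<Sum>\<sigma> | \<sigma> permutes {..<2 * n ^ n}. \<Sum>t\<in>torus_points n.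
      (dist (g (reduce n (\<lambda>i. t i + u (\<sigma> i)))) (g (reduce n (\<lambda>i. t i + v (\<sigma> i)))))\<^sup>2)
    = shift_energy n g (\<lambda>i. u i - v i)"
  unfolding shift_energy_def
proof (rule sum.cong[OF HOL.refl])
  fix \<sigma>
  let ?h = "\<lambda>t. (dist (g (reduce n (\<lambda>i. t i + (u (\<sigma> i) - v (\<sigma> i))))) (g t))\<^sup>2"
  show "(\<Sum>t\<in>torus_points n. (dist (g (reduce n (\<lambda>i. t i + u (\<sigma> i))))
      (g (reduce n (\<lambda>i. t i + v (\<sigma> i)))))\<^sup>2) = (\<Sum>t\<in>torus_points n. ?h t)"
    using sum_torus_shift[of ?h n "\<lambda>i. v (\<sigma> i)"] by (simp add: reduce_reduce_add)
qed

lemma shift_energy_permute: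
  assumes "\<tau> permutes {..<2 * n ^ n}" and w: "\<And>i. i < 2 * n ^ n \<Longrightarrow> w' i = w (\<tau> i)"
  shows "shift_energy n g w' = shift_energy n g w"
proof -
  let ?F = "\<lambda>\<sigma>. \<Sum>t\<in>torus_points n. (dist (g (reduce n (\<lambda>i. t i + w (\<sigma> i)))) (g t))\<^sup>2"
  have "reduce n (\<lambda>i. t i + w' (\<sigma> i)) = reduce n (\<lambda>i. t i + w ((\<tau> \<circ> \<sigma>) i))"
    if "\<sigma> permutes {..<2 * n ^ n}" for \<sigma> t
    using permutes_in_image[OF that] w by (intro reduce_cong) auto
  then have "shift_energy n g w' = (\<Sum>\<sigma> | \<sigma> permutes {..<2 * n ^ n}. ?F (\<tau> \<circ> \<sigma>))"
    unfolding shift_energy_def by (intro sum.cong) auto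
  also have "\<dots> = shift_energy n g w"
    unfolding shift_energy_def using setum_permutations_compose_left[OF assms(1), of ?F] by simp
  finally show ?thesis .
qed

text \<open>
  A displacement of scale \<open>2\<^bsup>k\<^esup>\<close>: the values are \<open>\<plusminus>2\<^bsup>k\<^esup>\<close>, equally often with either sign, and 0
  elsewhere. The support shrinks by the factor \<open>n\<close> when \<open>k\<close> grows by 1; this is what the
  double simplices below produce. At \<open>k = 0\<close> it consists of all \<open>2 n\<^bsup>n\<^esup>\<close> coordinates.
\<close>

definition balanced :: "nat \<Rightarrow> nat \<Rightarrow> (nat \<Rightarrow> int) \<Rightarrow> bool" where
  "balanced n k w \<longleftrightarrow>
     (\<forall>i<2 * n ^ n. w i \<in> {0, 2 ^ k, - (2 ^ k)}) \<and>
     card {i. i < 2 * n ^ n \<and> w i = 2 ^ k} = n ^ (n - k) \<and>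
     card {i. i < 2 * n ^ n \<and> w i = - (2 ^ k)} = n ^ (n - k)"

lemma balanced_card_fibre:
  assumes "balanced n k w"
  shows "card {i. i < 2 * n ^ n \<and> w i = c} =
    (if c = 2 ^ k \<or> c = - (2 ^ k) then n ^ (n - k)
     else if c = 0 then 2 * n ^ n - 2 * n ^ (n - k) else 0)"
proof -
  let ?P = "{i. i < 2 * n ^ n \<and> w i = 2 ^ k}" and ?M = "{i. i < 2 * n ^ n \<and> w i = - (2 ^ k)}"
  have pos: "(2::int) ^ k > 0" by simp
  have "{i. i < 2 * n ^ n \<and> w i = 0} = {..<2 * n ^ n} - (?P \<union> ?M)"
    using assms pos by (auto simp: balanced_def)
  moreover have "card (?P \<union> ?M) = 2 * n ^ (n - k)"
    using assms pos by (subst card_Un_disjoint) (auto simp: balanced_def)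
  ultimately have "card {i. i < 2 * n ^ n \<and> w i = 0} = 2 * n ^ n - 2 * n ^ (n - k)"
    by (simp add: card_Diff_subset subset_iff)
  moreover have "{i. i < 2 * n ^ n \<and> w i = c} = {}" if "c \<notin> {0, 2 ^ k, - (2 ^ k)}"
    using assms that by (auto simp: balanced_def)
  ultimately show ?thesis
    using assms by (auto simp: balanced_def)
qed

text \<open>
  Two balanced vectors of the same scale take each value equally often, so they differ by a
  permutation of the coordinates.
\<close>

lemma shift_energy_balanced:
  assumes "balanced n k w" "balanced n k w'"
  shows "shift_energy n g w = shift_energy n g w'"
proof -
  \<comment> \<open>Equal fibre cardinalities yield equal image multisets, and these yield the permutation.\<close>
  have "count (image_mset w (mset_set {..<2 * n ^ n})) c
      = count (image_mset w' (mset_set {..<2 * n ^ n})) c" for c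
    using balanced_card_fibre[OF assms(1), of c] balanced_card_fibre[OF assms(2), of c]
    by (simp add: count_image_mset_eq_card_vimage)
  then have "image_mset w (mset_set {..<2 * n ^ n}) = image_mset w' (mset_set {..<2 * n ^ n})"
    by (simp add: multiset_eq_iff)
  then obtain \<tau> where "\<tau> permutes {..<2 * n ^ n}" "\<forall>i\<in>{..<2 * n ^ n}. w i = w' (\<tau> i)"
    using image_mset_eq_implies_permutes[of "{..<2 * n ^ n}" w w'] by auto
  then show ?thesis by (intro shift_energy_permute) auto
qed

lemma card_blocks:
  fixes s :: nat
  assumes "s > 0" "Q \<subseteq> {..<r}" "r * s \<le> N"
  shows "card {x. x < N \<and> x div s \<in> Q} = card Q * s"
proof -
  have "{x. x < N \<and> x div s \<in> Q} = (\<lambda>(q, j). q * s + j) ` (Q \<times> {..<s})"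
  proof (intro equalityI subsetI)
    fix x assume "x \<in> {x. x < N \<and> x div s \<in> Q}"
    then show "x \<in> (\<lambda>(q, j). q * s + j) ` (Q \<times> {..<s})"
      using assms(1) by (intro image_eqI[of _ _ "(x div s, x mod s)"]) auto
  next
    fix x assume "x \<in> (\<lambda>(q, j). q * s + j) ` (Q \<times> {..<s})"
    then obtain q j where x: "q \<in> Q" "j < s" "x = q * s + j" by auto
    have "x < (q + 1) * s" using x by simp
    also have "\<dots> \<le> r * s" using x(1) assms(2) by (intro mult_right_mono) auto
    finally show "x \<in> {x. x < N \<and> x div s \<in> Q}" using x assms(1,3) by auto
  qed
  moreover have "q = q' \<and> j = j'" if "j < s" "j' < s" "q * s + j = q' * s + j'" for q q' j j'
  proof -
    have "(q * s + j) div s = q" "(q' * s + j') div s = q'" using that(1,2) by auto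
    then show ?thesis using that(3) by (metis add_left_cancel)
  qed
  then have "inj_on (\<lambda>(q, j). q * s + j) (Q \<times> {..<s})"
    unfolding inj_on_def Ball_def mem_Times_iff split_beta lessThan_iff prod_eq_iff by blast
  ultimately show ?thesis by (simp add: card_image card_cartesian_product)
qed

text \<open>
  Split \<open>2 n\<^bsup>n-k\<^esup>\<close> coordinates into \<open>2 n\<close> blocks of size \<open>s\<close>. Up to the factor \<open>2\<^bsup>k\<^esup>\<close>, the point
  \<open>a\<^sub>p\<close> is 1 on the last \<open>n\<close> blocks and 0 on the first \<open>n\<close>, except for a 2 on block \<open>p\<close>; the
  points \<open>b\<^sub>q\<close> are obtained by exchanging the two halves. Then \<open>a\<^sub>p - a\<^sub>q\<close> is \<open>\<plusminus>2\<close> on two blocks and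
  vanishes on the others, whereas \<open>a\<^sub>p - b\<^sub>q\<close> is \<open>\<plusminus>1\<close> on all \<open>2 n\<close> blocks, with \<open>n\<close> blocks of
  either sign.
\<close>

lemma double_simplex_in_torus:
  assumes "k < n"
  shows "\<exists>a b :: nat \<Rightarrow> nat \<Rightarrow> int.
    (\<forall>p<n. \<forall>q<n. p \<noteq> q \<longrightarrow> balanced n (Suc k) (\<lambda>x. a p x - a q x)) \<and>
    (\<forall>p<n. \<forall>q<n. p \<noteq> q \<longrightarrow> balanced n (Suc k) (\<lambda>x. b p x - b q x)) \<and>
    (\<forall>p<n. \<forall>q<n. balanced n k (\<lambda>x. a p x - b q x))"
proof -
  define s where "s = n ^ (n - Suc k)"
  define a :: "nat \<Rightarrow> nat \<Rightarrow> int" where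
    "a p x = (if x div s < n then if x div s = p then 2 ^ Suc k else 0
              else if x div s < 2 * n then 2 ^ k else 0)" for p x
  define b :: "nat \<Rightarrow> nat \<Rightarrow> int" where
    "b q x = (if x div s < n then 2 ^ k
              else if x div s = n + q then 2 ^ Suc k else 0)" for q x
  have s: "s > 0" using assms by (simp add: s_def)
  have ns: "n * s = n ^ (n - k)"
    using assms by (simp add: s_def flip: power_Suc Suc_diff_Suc)
  have "n * s \<le> n ^ n" unfolding ns using assms by (intro power_increasing) auto
  then have N: "2 * n * s \<le> 2 * n ^ n" by simp
  have pos: "(2::int) ^ k > 0" by simp
  note card = card_blocks[OF s _ N]
  have fib: "card {x. x < 2 * n ^ n \<and> P x} = card Q * s"
    if "Q \<subseteq> {..<2 * n}" "\<And>x. P x \<longleftrightarrow> x div s \<in> Q" for P Q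
    using card[OF that(1)] by (simp add: that(2))
  show ?thesis
  proof (rule exI[of _ a], rule exI[of _ b], intro conjI allI impI)
    fix p q assume pq: "p < n" "q < n" "p \<noteq> q"
    have "card {x. x < 2 * n ^ n \<and> a p x - a q x = 2 ^ Suc k} = card {p} * s"
      "card {x. x < 2 * n ^ n \<and> a p x - a q x = - (2 ^ Suc k)} = card {q} * s"
      by (rule fib; use pq pos in \<open>auto simp: a_def split: if_splits\<close>)+
    then show "balanced n (Suc k) (\<lambda>x. a p x - a q x)"
      using pq by (auto simp: balanced_def s_def a_def)
  next
    fix p q assume pq: "p < n" "q < n" "p \<noteq> q"
    have "card {x. x < 2 * n ^ n \<and> b p x - b q x = 2 ^ Suc k} = card {n + p} * s"
      "card {x. x < 2 * n ^ n \<and> b p x - b q x = - (2 ^ Suc k)} = card {n + q} * s"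
      by (rule fib; use pq pos in \<open>auto simp: b_def split: if_splits\<close>)+
    then show "balanced n (Suc k) (\<lambda>x. b p x - b q x)"
      using pq by (auto simp: balanced_def s_def b_def)
  next
    fix p q assume pq: "p < n" "q < n"
    have P: "card {x. x < 2 * n ^ n \<and> a p x - b q x = 2 ^ k}
        = card (insert p ({n..<2 * n} - {n + q})) * s"
      by (rule fib; use pq pos in \<open>auto simp: a_def b_def split: if_splits\<close>)
    have M: "card {x. x < 2 * n ^ n \<and> a p x - b q x = - (2 ^ k)}
        = card (insert (n + q) ({..<n} - {p})) * s"
      by (rule fib; use pq pos in \<open>auto simp: a_def b_def split: if_splits\<close>)
    have "card (insert p ({n..<2 * n} - {n + q})) = n" "card (insert (n + q) ({..<n} - {p})) = n"
      using pq by (simp_all add: card_insert_if)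
    then show "balanced n k (\<lambda>x. a p x - b q x)"
      using P M pq ns by (auto simp: balanced_def a_def b_def)
  qed
qed

section \<open>Distortion of the torus in Hilbert space\<close>

text \<open>
  The double simplex inequality for the images of all translated and permuted copies of one
  double simplex, summed up. Each side contributes the energy of \<open>w'\<close> and each connecting
  segment that of \<open>w\<close>; there are \<open>2 n (n - 1)\<close> ordered sides, and \<open>n\<^sup>2\<close> connecting segments that
  count twice.
\<close>

lemma shift_energy_doubling:
  fixes g :: "(nat \<Rightarrow> int) \<Rightarrow> 'h :: real_inner"
  assumes "k < n" "balanced n k w" "balanced n (Suc k) w'"
  shows "(real n - 1) * shift_energy n g w' \<le> real n * shift_energy n g w"
proof -
  obtain a b :: "nat \<Rightarrow> nat \<Rightarrow> int" where
    a: "\<forall>p<n. \<forall>q<n. p \<noteq> q \<longrightarrow> balanced n (Suc k) (\<lambda>x. a p x - a q x)" and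
    b: "\<forall>p<n. \<forall>q<n. p \<noteq> q \<longrightarrow> balanced n (Suc k) (\<lambda>x. b p x - b q x)" and
    ab: "\<forall>p<n. \<forall>q<n. balanced n k (\<lambda>x. a p x - b q x)"
    using double_simplex_in_torus[OF assms(1)] by auto
  define P where "P = {\<sigma>. \<sigma> permutes {..<2 * n ^ n}}"
  define pt where "pt \<sigma> t u = g (reduce n (\<lambda>i. t i + u (\<sigma> i)))"
    for \<sigma> :: "nat \<Rightarrow> nat" and t u :: "nat \<Rightarrow> int"
  define D where "D u v = (\<Sum>\<sigma>\<in>P. \<Sum>t\<in>torus_points n. (dist (pt \<sigma> t u) (pt \<sigma> t v))\<^sup>2)"
    for u v :: "nat \<Rightarrow> int"
  have D: "D u v = shift_energy n g (\<lambda>i. u i - v i)" for u v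
    unfolding D_def P_def pt_def by (rule shift_energy_diff)
  have pull_out: "(\<Sum>p<n. \<Sum>q<n. D (u p) (v q)) = (\<Sum>\<sigma>\<in>P. \<Sum>t\<in>torus_points n.
      \<Sum>p<n. \<Sum>q<n. (dist (pt \<sigma> t (u p)) (pt \<sigma> t (v q)))\<^sup>2)"
    for u v :: "nat \<Rightarrow> nat \<Rightarrow> int"
  proof -
    have "(\<Sum>p<n. \<Sum>q<n. D (u p) (v q)) = (\<Sum>p<n. \<Sum>\<sigma>\<in>P. \<Sum>q<n. \<Sum>t\<in>torus_points n.
        (dist (pt \<sigma> t (u p)) (pt \<sigma> t (v q)))\<^sup>2)"
      unfolding D_def by (rule sum.cong[OF HOL.refl], rule sum.swap)
    also have "\<dots> = (\<Sum>\<sigma>\<in>P. \<Sum>p<n. \<Sum>q<n. \<Sum>t\<in>torus_points n.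
        (dist (pt \<sigma> t (u p)) (pt \<sigma> t (v q)))\<^sup>2)"
      by (rule sum.swap)
    also have "\<dots> = (\<Sum>\<sigma>\<in>P. \<Sum>p<n. \<Sum>t\<in>torus_points n. \<Sum>q<n.
        (dist (pt \<sigma> t (u p)) (pt \<sigma> t (v q)))\<^sup>2)"
      by (rule sum.cong[OF HOL.refl], rule sum.cong[OF HOL.refl], rule sum.swap)
    also have "\<dots> = (\<Sum>\<sigma>\<in>P. \<Sum>t\<in>torus_points n. \<Sum>p<n. \<Sum>q<n.
        (dist (pt \<sigma> t (u p)) (pt \<sigma> t (v q)))\<^sup>2)"
      by (rule sum.cong[OF HOL.refl], rule sum.swap)
    finally show ?thesis .
  qed
  have within: "(\<Sum>p<n. \<Sum>q<n. D (c p) (c q)) = real n * ((real n - 1) * shift_energy n g w')"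
    if c: "\<forall>p<n. \<forall>q<n. p \<noteq> q \<longrightarrow> balanced n (Suc k) (\<lambda>x. c p x - c q x)"
    for c :: "nat \<Rightarrow> nat \<Rightarrow> int"
  proof -
    have "(\<Sum>q<n. D (c p) (c q)) = (real n - 1) * shift_energy n g w'" if "p < n" for p
    proof -
      have "(\<Sum>q<n. D (c p) (c q)) = D (c p) (c p) + (\<Sum>q\<in>{..<n} - {p}. D (c p) (c q))"
        using that by (intro sum.remove) auto
      also have "(\<Sum>q\<in>{..<n} - {p}. D (c p) (c q)) =
          (\<Sum>q\<in>{..<n} - {p}. shift_energy n g w')"
        unfolding D using that c assms(3)
        by (intro sum.cong HOL.refl shift_energy_balanced) auto
      also have "D (c p) (c p) = 0" by (simp add: D_def)
      finally show ?thesis using that by (simp add: of_nat_diff)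
    qed
    then show ?thesis by simp
  qed
  have across: "(\<Sum>p<n. \<Sum>q<n. D (a p) (b q)) = real n * (real n * shift_energy n g w)"
  proof -
    have "D (a p) (b q) = shift_energy n g w" if "p < n" "q < n" for p q
      unfolding D using ab that assms(2) by (intro shift_energy_balanced) auto
    then show ?thesis by simp
  qed
  have "(\<Sum>p<n. \<Sum>q<n. D (a p) (a q)) + (\<Sum>p<n. \<Sum>q<n. D (b p) (b q))
      \<le> 2 * (\<Sum>p<n. \<Sum>q<n. D (a p) (b q))"
  proof -
    let ?S = "\<lambda>u v \<sigma> t. \<Sum>p<n. \<Sum>q<n. (dist (pt \<sigma> t (u p)) (pt \<sigma> t (v q)))\<^sup>2"
    have "(\<Sum>\<sigma>\<in>P. \<Sum>t\<in>torus_points n. ?S a a \<sigma> t + ?S b b \<sigma> t)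
        \<le> (\<Sum>\<sigma>\<in>P. \<Sum>t\<in>torus_points n. 2 * ?S a b \<sigma> t)"
      by (intro sum_mono double_simplex_inequality)
    then show ?thesis by (simp only: pull_out sum.distrib sum_distrib_left[symmetric])
  qed
  then have "real n * ((real n - 1) * shift_energy n g w')
      \<le> real n * (real n * shift_energy n g w)"
    using within[OF a] within[OF b] across by simp
  then show ?thesis using assms(1) by simp
qed

lemma balanced_exists:
  assumes "k \<le> n" "n \<ge> 2"
  obtains w where "balanced n k w"
proof (cases "k = n")
  case True
  have "n - 1 < n" using assms by simp
  from double_simplex_in_torus[OF this] obtain a :: "nat \<Rightarrow> nat \<Rightarrow> int" where
    "\<forall>p<n. \<forall>q<n. p \<noteq> q \<longrightarrow> balanced n (Suc (n - 1)) (\<lambda>x. a p x - a q x)"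
    by auto
  then have "balanced n (Suc (n - 1)) (\<lambda>x. a 0 x - a 1 x)" using assms by simp
  then show thesis using that True assms by simp
next
  case False
  then have "k < n" using assms by simp
  from double_simplex_in_torus[OF this] obtain a b :: "nat \<Rightarrow> nat \<Rightarrow> int" where
    "\<forall>p<n. \<forall>q<n. balanced n k (\<lambda>x. a p x - b q x)"
    by auto
  then have "balanced n k (\<lambda>x. a 0 x - b 0 x)" using assms by simp
  then show thesis by (rule that)
qed

lemma shift_energy_scale:
  fixes g :: "(nat \<Rightarrow> int) \<Rightarrow> 'h :: real_inner"
  assumes "n \<ge> 2" "k \<le> n" "balanced n 0 w" "balanced n k w'"
  shows "(1 - 1 / real n) ^ k * shift_energy n g w' \<le> shift_energy n g w"
  using assms(2,4)
proof (induction k arbitrary: w')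
  case 0
  then show ?case using shift_energy_balanced[OF assms(3) 0(2), of g] by simp
next
  case (Suc k)
  obtain v where v: "balanced n k v" using balanced_exists[of k n] Suc.prems assms(1) by auto
  have "(real n - 1) * shift_energy n g w' \<le> real n * shift_energy n g v"
    using shift_energy_doubling[OF _ v Suc.prems(2)] Suc.prems(1) by simp
  then have "(1 - 1 / real n) * shift_energy n g w' \<le> shift_energy n g v"
    using assms(1) by (simp add: field_simps)
  then have "(1 - 1 / real n) ^ k * ((1 - 1 / real n) * shift_energy n g w')
      \<le> (1 - 1 / real n) ^ k * shift_energy n g v"
    using assms(1) by (intro mult_left_mono) auto
  also have "\<dots> \<le> shift_energy n g w" using Suc.IH[OF _ v] Suc.prems(1) by simp
  finally show ?case by (simp add: mult_ac)
qed

text \<open>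
  From \<open>1 / (1 - 1/n) = 1 + 1/(n - 1) \<le> exp (2/n)\<close> the \<open>n\<close>-th power of \<open>1 - 1/n\<close> is at
  least \<open>exp (-2)\<close>, and \<open>exp 1 \<le> 3\<close>.
\<close>

lemma ninth_le_power:
  assumes "n \<ge> (2::nat)"
  shows "1 / 9 \<le> (1 - 1 / real n) ^ n"
proof -
  have n: "real n \<ge> 2" using assms by simp
  have "1 / (1 - 1 / real n) = 1 + 1 / (real n - 1)" using n by (simp add: field_simps)
  also have "\<dots> \<le> exp (1 / (real n - 1))" by (rule exp_ge_add_one_self)
  also have "\<dots> \<le> exp (2 / real n)" using n by (simp add: field_simps)
  finally have "(1 / (1 - 1 / real n)) ^ n \<le> exp (2 / real n) ^ n"
    using n by (intro power_mono) auto
  also have "\<dots> = exp (real n * (2 / real n))" by (rule exp_of_nat_mult[symmetric])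
  also have "\<dots> = exp 1 ^ 2" using n by (simp add: power2_eq_square flip: exp_add)
  also have "\<dots> \<le> 3 ^ 2" by (intro power_mono exp_le) auto
  finally have "1 / (1 - 1 / real n) ^ n \<le> 9" by (simp add: power_one_over)
  then show ?thesis using n by (simp add: field_simps)
qed

text \<open>
  A displacement by at most half of the circumference \<open>2\<^bsup>n+1\<^esup>\<close> is the cyclic distance that it
  produces. This limits the scales to \<open>k \<le> n\<close>.
\<close>

lemma cyc_dist_add_mod:
  assumes "t \<in> cyc_points n" "\<bar>d\<bar> \<le> 2 ^ n"
  shows "cyc_dist n ((t + d) mod 2 ^ (n + 1)) t = \<bar>d\<bar>"
proof -
  have t: "0 \<le> t" "t < 2 * 2 ^ n" using assms(1) by (auto simp: cyc_points_def)
  have pos: "(2::int) ^ n > 0" by simp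
  consider "0 \<le> t + d" "t + d < 2 * 2 ^ n" | "t + d < 0" | "t + d \<ge> 2 * 2 ^ n" by linarith
  then have "(t + d) mod (2 * 2 ^ n) = t + d \<or> (t + d) mod (2 * 2 ^ n) = t + d + 2 * 2 ^ n \<and> d < 0
    \<or> (t + d) mod (2 * 2 ^ n) = t + d - 2 * 2 ^ n \<and> d > 0"
  proof cases
    case 1
    then show ?thesis by simp
  next
    case 2
    have "(t + d) mod (2 * 2 ^ n) = (t + d + 2 * 2 ^ n) mod (2 * 2 ^ n)" by simp
    also have "\<dots> = t + d + 2 * 2 ^ n" using 2 t assms(2) by (intro mod_pos_pos_trivial) auto
    finally show ?thesis using 2 t by simp
  next
    case 3
    have "(t + d) mod (2 * 2 ^ n) = (t + d - 2 * 2 ^ n) mod (2 * 2 ^ n)" by simp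
    also have "\<dots> = t + d - 2 * 2 ^ n" using 3 t assms(2) by (intro mod_pos_pos_trivial) auto
    finally show ?thesis using 3 t by simp
  qed
  then show ?thesis
    using assms(2) t pos unfolding cyc_dist_def by (auto simp: min_def)
qed

lemma torus_dist_shift:
  assumes "balanced n k w" "k \<le> n" "n \<ge> 1" "\<sigma> permutes {..<2 * n ^ n}" "t \<in> torus_points n"
  shows "torus_dist n (reduce n (\<lambda>i. t i + w (\<sigma> i))) t = 2 ^ k"
proof -
  let ?N = "2 * n ^ n"
  have coord: "cyc_dist n (reduce n (\<lambda>i. t i + w (\<sigma> i)) i) (t i) = \<bar>w (\<sigma> i)\<bar>"
    and val: "w (\<sigma> i) \<in> {0, 2 ^ k, - (2 ^ k)}" if "i < ?N" for i
  proof -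
    show w: "w (\<sigma> i) \<in> {0, 2 ^ k, - (2 ^ k)}"
      using assms(1,4) that permutes_in_image[OF assms(4), of i] by (auto simp: balanced_def)
    have "(2::int) ^ k \<le> 2 ^ n" using assms(2) by (intro power_increasing) auto
    then have "\<bar>w (\<sigma> i)\<bar> \<le> 2 ^ n" using w by auto
    moreover have "t i \<in> cyc_points n" using assms(5) that by (auto simp: torus_points_def)
    ultimately show "cyc_dist n (reduce n (\<lambda>i. t i + w (\<sigma> i)) i) (t i) = \<bar>w (\<sigma> i)\<bar>"
      using that cyc_dist_add_mod[of "t i" n "w (\<sigma> i)"] by (simp add: reduce_def)
  qed
  have "card {i. i < ?N \<and> w i = 2 ^ k} > 0"
    using assms(1,3) by (simp add: balanced_def)
  then obtain j where "j < ?N" "w j = 2 ^ k"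
    by (metis (mono_tags, lifting) Collect_empty_eq card.empty less_irrefl)
  then obtain i where i: "i < ?N" "w (\<sigma> i) = 2 ^ k"
    using permutes_image[OF assms(4)] by (metis (no_types, lifting) imageE lessThan_iff)
  show ?thesis
    unfolding torus_dist_def
  proof (rule Max_eqI)
    show "2 ^ k \<in> (\<lambda>i. cyc_dist n (reduce n (\<lambda>i. t i + w (\<sigma> i)) i) (t i)) ` {..<?N}"
      using i coord by (intro image_eqI[of _ _ i]) auto
  next
    fix y assume "y \<in> (\<lambda>i. cyc_dist n (reduce n (\<lambda>i. t i + w (\<sigma> i)) i) (t i)) ` {..<?N}"
    then obtain i where "i < ?N" "y = \<bar>w (\<sigma> i)\<bar>" using coord by auto
    then show "y \<le> 2 ^ k" using val[of i] by auto
  qed simp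
qed

text \<open>
  The energy at scale 1 is a sum of squared lengths of images of edges, and the energy at scale
  \<open>2\<^bsup>n\<^esup>\<close> is such a sum over pairs at distance \<open>2\<^bsup>n\<^esup>\<close>. Both sums have
  the same number of terms, so the comparison of energies becomes one of lengths. The constant does
  not depend on \<open>n\<close>.
\<close>

lemma hilbert_torus_distortion:
  fixes g :: "(nat \<Rightarrow> int) \<Rightarrow> 'h :: real_inner"
  assumes "n \<ge> 2" "L \<ge> 0"
    and short: "\<And>x y. \<lbrakk>x \<in> torus_points n; y \<in> torus_points n; torus_dist n x y = 1\<rbrakk>
      \<Longrightarrow> dist (g x) (g y) \<le> C"
    and long: "\<And>x y. \<lbrakk>x \<in> torus_points n; y \<in> torus_points n; torus_dist n x y = 2 ^ n\<rbrakk>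
      \<Longrightarrow> L \<le> dist (g x) (g y)"
  shows "L \<le> 3 * C"
proof -
  obtain w w' where w: "balanced n 0 w" and w': "balanced n n w'"
    using balanced_exists assms(1) by (metis le0 order_refl)
  define P where "P = {\<sigma>. \<sigma> permutes {..<2 * n ^ n}}"
  define c where "c = real (card P) * real (card (torus_points n))"
  have "finite P" "id \<in> P" by (auto simp: P_def finite_permutations permutes_id)
  then have c: "c > 0" unfolding c_def using torus_points_nonempty
    by (auto intro!: mult_pos_pos simp: card_gt_0_iff)
  have "shift_energy n g w \<le> (\<Sum>\<sigma>\<in>P. \<Sum>t\<in>torus_points n. C\<^sup>2)"
    unfolding shift_energy_def P_def using assms(1)
    by (intro sum_mono power_mono short) (auto simp: torus_dist_shift[OF w])
  then have upper: "shift_energy n g w \<le> c * C\<^sup>2" by (simp add: c_def mult_ac)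
  have "(\<Sum>\<sigma>\<in>P. \<Sum>t\<in>torus_points n. L\<^sup>2) \<le> shift_energy n g w'"
    unfolding shift_energy_def P_def using assms(1,2)
    by (intro sum_mono power_mono long) (auto simp: torus_dist_shift[OF w'])
  then have lower: "c * L\<^sup>2 \<le> shift_energy n g w'" by (simp add: c_def mult_ac)
  have "1 / 9 * (c * L\<^sup>2) \<le> (1 - 1 / real n) ^ n * shift_energy n g w'"
    using ninth_le_power[OF assms(1)] lower c assms(1) by (intro mult_mono) auto
  also have "\<dots> \<le> c * C\<^sup>2"
    using shift_energy_scale[OF assms(1) _ w w', of g] upper by simp
  finally have "c * L\<^sup>2 \<le> c * (3 * C)\<^sup>2" by (simp add: power_mult_distrib)
  moreover have "0 \<le> C"
  proof -
    obtain t :: "nat \<Rightarrow> int" where t: "t \<in> torus_points n" using torus_points_nonempty by blast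
    have "torus_dist n (reduce n (\<lambda>i. t i + w (id i))) t = 1"
      using torus_dist_shift[OF w _ _ permutes_id t] assms(1) by simp
    then show ?thesis using short[OF reduce_in_torus t] zero_le_dist order_trans by blast
  qed
  ultimately show ?thesis using c by (auto intro: power2_le_imp_le)
qed

section \<open>Word length in presented groups\<close>

abbreviation inv_word :: "'g letter list \<Rightarrow> 'g letter list" where
  "inv_word w \<equiv> map (\<lambda>(x, e). (x, \<not> e)) (rev w)"

abbreviation word_class :: "'g set \<Rightarrow> 'g letter list set \<Rightarrow> 'g letter list \<Rightarrow> 'g letter list set" where
  "word_class X R w \<equiv> presentation_rel X R `` {w}"

lemma word_class_carrier: "w \<in> words_over X \<Longrightarrow> word_class X R w \<in> carrier (presented_group X R)"
  by (simp add: presented_group_def quotientI)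

lemma word_class_eqI:
  "(v, w) \<in> presentation_rel X R \<Longrightarrow> word_class X R v = word_class X R w"
  by (rule equiv_class_eq[OF equiv_presentation_rel])

lemma inv_word_class:
  assumes "w \<in> words_over X"
  shows "inv\<^bsub>presented_group X R\<^esub> (word_class X R w) = word_class X R (inv_word w)"
proof (rule group.inv_equality[OF group_presented_group])
  have u: "inv_word w \<in> words_over X" using assms by (rule words_over_rev_inverse)
  show "word_class X R (inv_word w) \<otimes>\<^bsub>presented_group X R\<^esub> word_class X R w
      = \<one>\<^bsub>presented_group X R\<^esub>"
    unfolding presented_mult_classes[OF u assms]
    using word_class_eqI[OF presentation_rel_inverse[OF assms]] by (simp add: presented_group_def)
qed (use assms in \<open>auto intro!: word_class_carrier words_over_rev_inverse\<close>)

lemma letter_classes: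
  "presented_gen X R ` X \<union> m_inv (presented_group X R) ` presented_gen X R ` X
    = (\<lambda>l. word_class X R [l]) ` (X \<times> UNIV)"
proof -
  have "inv\<^bsub>presented_group X R\<^esub> (presented_gen X R x) = word_class X R [(x, False)]"
    if "x \<in> X" for x
    using that by (simp add: presented_gen_def inv_word_class)
  then have "m_inv (presented_group X R) ` presented_gen X R ` X
      = (\<lambda>l. word_class X R [l]) ` (X \<times> {False})"
    by (auto simp: image_iff)
  moreover have "presented_gen X R ` X = (\<lambda>l. word_class X R [l]) ` (X \<times> {True})"
    by (auto simp: presented_gen_def image_iff)
  ultimately have "presented_gen X R ` X \<union> m_inv (presented_group X R) ` presented_gen X R ` X
      = (\<lambda>l. word_class X R [l]) ` (X \<times> {True} \<union> X \<times> {False})"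
    by (simp only: image_Un)
  also have "X \<times> {True} \<union> X \<times> {False} = X \<times> (UNIV :: bool set)" by auto
  finally show ?thesis .
qed

lemma foldr_letter_classes:
  "w \<in> words_over X \<Longrightarrow>
    foldr (mult (presented_group X R)) (map (\<lambda>l. word_class X R [l]) w)
      \<one>\<^bsub>presented_group X R\<^esub> = word_class X R w"
proof (induction w)
  case Nil
  then show ?case by (simp add: presented_group_def)
next
  case (Cons l w)
  then have "[l] \<in> words_over X" "w \<in> words_over X" by auto
  then show ?case using Cons.IH by (simp add: presented_mult_classes)
qed

text \<open>
  The word norm may be computed with words in the letters, since each generator or inverse of a
  generator is the class of a single letter.
\<close>

lemma word_norm_presented:
  "word_norm (presented_group X R) (presented_gen X R ` X) x
    = (LEAST n. \<exists>w\<in>words_over X. length w = n \<and> word_class X R w = x)"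
proof -
  let ?L = "\<lambda>l. word_class X R [l]"
  have "(\<exists>ws. length ws = n \<and> set ws \<subseteq> ?L ` (X \<times> UNIV) \<and>
        foldr (mult (presented_group X R)) ws \<one>\<^bsub>presented_group X R\<^esub> = x) \<longleftrightarrow>
      (\<exists>w\<in>words_over X. length w = n \<and> word_class X R w = x)" for n
  proof
    assume "\<exists>ws. length ws = n \<and> set ws \<subseteq> ?L ` (X \<times> UNIV) \<and>
      foldr (mult (presented_group X R)) ws \<one>\<^bsub>presented_group X R\<^esub> = x"
    then obtain ws where ws: "length ws = n" "set ws \<subseteq> ?L ` (X \<times> UNIV)"
      "foldr (mult (presented_group X R)) ws \<one>\<^bsub>presented_group X R\<^esub> = x" by blast
    then have "ws \<in> map ?L ` lists (X \<times> UNIV)" by (simp flip: lists_image) blast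
    then obtain w where w: "w \<in> lists (X \<times> UNIV)" "ws = map ?L w" by blast
    then have "w \<in> words_over X" by (simp add: words_over_def)
    then show "\<exists>w\<in>words_over X. length w = n \<and> word_class X R w = x"
      using ws(1,3) w(2) foldr_letter_classes[of w X R] by (intro bexI[of _ w]) simp_all
  next
    assume "\<exists>w\<in>words_over X. length w = n \<and> word_class X R w = x"
    then obtain w where w: "w \<in> words_over X" "length w = n" "word_class X R w = x" by blast
    have "set (map ?L w) \<subseteq> ?L ` (X \<times> UNIV)"
      using w(1) by (auto simp: words_over_def in_lists_conv_set)
    then show "\<exists>ws. length ws = n \<and> set ws \<subseteq> ?L ` (X \<times> UNIV) \<and>
      foldr (mult (presented_group X R)) ws \<one>\<^bsub>presented_group X R\<^esub> = x"
      using w foldr_letter_classes[OF w(1), of R] by (intro exI[of _ "map ?L w"]) simp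
  qed
  then show ?thesis unfolding word_norm_def letter_classes by presburger
qed

lemma word_norm_class_le:
  assumes "w \<in> words_over X"
  shows "word_norm (presented_group X R) (presented_gen X R ` X) (word_class X R w) \<le> length w"
  unfolding word_norm_presented using assms by (intro Least_le) blast

lemma word_norm_class_attained:
  assumes "w \<in> words_over X"
  obtains v where "v \<in> words_over X" "(v, w) \<in> presentation_rel X R"
    "length v = word_norm (presented_group X R) (presented_gen X R ` X) (word_class X R w)"
proof -
  let ?n = "word_norm (presented_group X R) (presented_gen X R ` X) (word_class X R w)"
  have "\<exists>v\<in>words_over X. length v = ?n \<and> word_class X R v = word_class X R w"
    unfolding word_norm_presented by (rule LeastI_ex) (use assms in blast)
  then obtain v where v: "v \<in> words_over X" "length v = ?n" "word_class X R v = word_class X R w"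
    by blast
  then show thesis
    using that eq_equiv_class[OF v(3) equiv_presentation_rel assms] by blast
qed

text \<open>
  A function \<open>h\<close> on the generators, extended to letters; summed over a word it is the value of the
  homomorphism from the free group to the integers that extends \<open>h\<close>.
\<close>

definition letter_value :: "('g \<Rightarrow> int) \<Rightarrow> 'g letter \<Rightarrow> int" where
  "letter_value h l = (if snd l then h (fst l) else - h (fst l))"

lemma letter_value_inverse: "letter_value h (x, \<not> e) = - letter_value h (x, e)"
  by (simp add: letter_value_def)

lemma sum_letter_value_inv_word:
  "sum_list (map (letter_value h) (inv_word w)) = - sum_list (map (letter_value h) w)"
  by (induction w) (auto simp: letter_value_inverse)

text \<open>
  Such a homomorphism descends to the presented group if it vanishes on the relators.
\<close>

lemma presentation_rel_value:
  assumes "\<And>r. r \<in> R \<Longrightarrow> sum_list (map (letter_value h) r) = 0"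
    and "(v, w) \<in> presentation_rel X R"
  shows "sum_list (map (letter_value h) v) = sum_list (map (letter_value h) w)"
  using assms(2) by (induction rule: presentation_rel.induct)
    (auto simp: assms(1) letter_value_inverse)

text \<open>
  Evaluate the homomorphism on a shortest representative.
\<close>

lemma word_norm_ge_value:
  assumes "\<And>r. r \<in> R \<Longrightarrow> sum_list (map (letter_value h) r) = 0"
    and bound: "\<And>x. x \<in> X \<Longrightarrow> \<bar>h x\<bar> \<le> 1"
    and w: "w \<in> words_over X"
  shows "\<bar>sum_list (map (letter_value h) w)\<bar>
    \<le> int (word_norm (presented_group X R) (presented_gen X R ` X) (word_class X R w))"
proof -
  obtain v where v: "v \<in> words_over X" "(v, w) \<in> presentation_rel X R" and
    len: "length v = word_norm (presented_group X R) (presented_gen X R ` X) (word_class X R w)"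
    using word_norm_class_attained[OF w] by blast
  have "\<bar>sum_list (map (letter_value h) v)\<bar> \<le> int (length v)"
    using v(1)
  proof (induction v)
    case (Cons l v)
    then have "\<bar>letter_value h l\<bar> \<le> 1" using bound by (auto simp: letter_value_def)
    then show ?case using Cons by simp
  qed simp
  then show ?thesis using presentation_rel_value[OF assms(1) v(2)] len by simp
qed

lemma word_dist_classes:
  assumes "u \<in> words_over X" "v \<in> words_over X"
  shows "word_dist (presented_group X R) S (word_class X R u) (word_class X R v)
    = real (word_norm (presented_group X R) S (word_class X R (inv_word u @ v)))"
  using assms by (simp add: word_dist_def inv_word_class presented_mult_classes
      words_over_rev_inverse)

section \<open>Walks and the edge group\<close>

lemma pcas_append: "pcas u p v \<Longrightarrow> pcas v q w \<Longrightarrow> pcas u (p @ q) w"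
  by (induction p arbitrary: u) auto

lemma pcas_rev: "pcas u p v \<Longrightarrow> pcas v (map prod.swap (rev p)) u"
  by (induction p arbitrary: u) (auto intro!: pcas_append)

abbreviation pawalk :: "'v pair_pre_digraph \<Rightarrow> 'v \<Rightarrow> ('v \<times> 'v) list \<Rightarrow> 'v \<Rightarrow> bool" where
  "pawalk G \<equiv> pre_digraph.awalk (with_proj G)"

lemma pawalk_iff: "pawalk G u p v \<longleftrightarrow> u \<in> pverts G \<and> set p \<subseteq> parcs G \<and> pcas u p v"
  by (simp add: pre_digraph.awalk_def cas_with_proj_eq)

lemma rtrancl_imp_pawalk:
  assumes "(u, v) \<in> (parcs G)\<^sup>*" "v \<in> pverts G" "parcs G \<subseteq> pverts G \<times> pverts G"
  shows "\<exists>p. pawalk G u p v"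
  using assms(1)
proof (induction rule: converse_rtrancl_induct)
  case base
  then show ?case using assms(2) by (intro exI[of _ "[]"]) (simp add: pawalk_iff)
next
  case (step u w)
  then obtain p where "pawalk G w p v" by blast
  then show ?case using step(1) assms(3) by (intro exI[of _ "(u, w) # p"]) (auto simp: pawalk_iff)
qed

lemma arc_letter_swap:
  assumes "orientation G A" "e \<in> parcs G"
  shows "arc_letter A (prod.swap e) = (\<lambda>(x, b). (x, \<not> b)) (arc_letter A e)"
  using assms by (cases e) (auto simp: orientation_def arc_letter_def)

lemma walk_word_rev:
  assumes "orientation G A" "set p \<subseteq> parcs G"
  shows "map (arc_letter A) (map prod.swap (rev p)) = inv_word (map (arc_letter A) p)"
  using assms arc_letter_swap[OF assms(1)] by (auto simp: rev_map subset_iff)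

lemma walk_word_words_over:
  assumes "orientation G A" "set p \<subseteq> parcs G"
  shows "map (arc_letter A) p \<in> words_over A"
  using assms(2)
proof (induction p)
  case (Cons e p)
  then show ?case
    using assms(1) by (cases e) (auto simp: orientation_def arc_letter_def)
qed simp

text \<open>
  A telescoping sum: the orientation of an edge does not affect its value, because the reversal of the
  edge and the inversion of the letter both change the sign.
\<close>

lemma sum_letter_value_walk:
  assumes "pcas u p v"
  shows "sum_list (map (letter_value (\<lambda>e. \<phi> (snd e) - \<phi> (fst e))) (map (arc_letter A) p))
    = \<phi> v - \<phi> u"
  using assms by (induction p arbitrary: u) (auto simp: arc_letter_def letter_value_def)

text \<open>
  Traversing \<open>p\<close> forwards and \<open>q\<close> backwards is a loop, hence a relator.
\<close>

lemma parallel_walks_class_eq: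
  assumes ori: "orientation G A" and "sym (parcs G)" and p: "pawalk G u p v" and q: "pawalk G u q v"
  shows "word_class A (loop_words G A) (map (arc_letter A) p)
    = word_class A (loop_words G A) (map (arc_letter A) q)"
proof -
  let ?R = "loop_words G A" and ?p = "map (arc_letter A) p" and ?q = "map (arc_letter A) q"
  have P: "?p \<in> words_over A" and Q: "?q \<in> words_over A"
    using p q by (auto simp: pawalk_iff intro!: walk_word_words_over[OF ori])
  have "pawalk G u (p @ map prod.swap (rev q)) u"
    using p q assms(2) by (auto simp: pawalk_iff sym_def intro: pcas_append pcas_rev)
  then have "map (arc_letter A) (p @ map prod.swap (rev q)) \<in> ?R"
    unfolding loop_words_def by blast
  moreover have "map (arc_letter A) (p @ map prod.swap (rev q)) = ?p @ inv_word ?q"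
    using walk_word_rev[OF ori, of q] q by (simp add: pawalk_iff)
  ultimately have "?p @ inv_word ?q \<in> ?R \<inter> words_over A"
    using loop_words_subset[OF ori] by auto
  then have "(?p @ inv_word ?q @ ?q, ?q) \<in> presentation_rel A ?R"
    using presentation_rel.relator[of "[]" A ?q "?p @ inv_word ?q" ?R] Q by simp
  moreover have "(?p @ inv_word ?q @ ?q, ?p) \<in> presentation_rel A ?R"
    using presentation_rel_context[OF presentation_rel_inverse[OF Q], of ?p "[]" ?R] P by simp
  ultimately have "(?p, ?q) \<in> presentation_rel A ?R"
    by (blast intro: presentation_rel.sym presentation_rel.trans)
  then show ?thesis by (rule word_class_eqI)
qed

text \<open>
  The image in the edge group of a vertex \<open>v\<close>, relative to a root \<open>r\<close>. By the
  preceding lemma the choice of the walk is immaterial; a value for unreachable \<open>v\<close> is junk.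
\<close>

definition vertex_element ::
  "'v pair_pre_digraph \<Rightarrow> 'v rel \<Rightarrow> 'v \<Rightarrow> 'v \<Rightarrow> ('v \<times> 'v) letter list set" where
  "vertex_element G A r v =
     word_class A (loop_words G A) (map (arc_letter A) (SOME p. pawalk G r p v))"

lemma vertex_element_eq:
  assumes "orientation G A" "sym (parcs G)" "pawalk G r p v"
  shows "vertex_element G A r v = word_class A (loop_words G A) (map (arc_letter A) p)"
  unfolding vertex_element_def
  using assms by (intro parallel_walks_class_eq[OF assms(1,2) someI]) auto

lemma vertex_element_carrier:
  assumes "orientation G A" "sym (parcs G)" "pawalk G r p v"
  shows "vertex_element G A r v \<in> carrier (edge_group G A)"
  unfolding vertex_element_eq[OF assms] edge_group_def
  using assms walk_word_words_over[OF assms(1)] by (auto simp: pawalk_iff intro: word_class_carrier)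

text \<open>
  Extending a walk to \<open>u\<close> by the edge gives a walk to \<open>v\<close>, so the two elements differ by one
  letter.
\<close>

lemma word_dist_vertex_element_arc:
  assumes ori: "orientation G A" and sym: "sym (parcs G)" and p: "pawalk G r p u"
    and arc: "(u, v) \<in> parcs G"
  shows "word_dist (edge_group G A) (edge_gens G A)
    (vertex_element G A r u) (vertex_element G A r v) \<le> 1"
proof -
  let ?R = "loop_words G A" and ?p = "map (arc_letter A) p" and ?l = "[arc_letter A (u, v)]"
  have P: "?p \<in> words_over A" and l: "?l \<in> words_over A"
    using p arc walk_word_words_over[OF ori, of p] walk_word_words_over[OF ori, of "[(u, v)]"]
    by (auto simp: pawalk_iff)
  have "pawalk G r (p @ [(u, v)]) v" using p arc by (auto simp: pawalk_iff intro: pcas_append)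
  from vertex_element_eq[OF ori sym this]
  have v: "vertex_element G A r v = word_class A ?R (?p @ ?l)" by simp
  have "(inv_word ?p @ ?p @ ?l, ?l) \<in> presentation_rel A ?R"
    using presentation_rel_context[OF presentation_rel_inverse[OF P], of "[]" ?l ?R] l by simp
  then have "word_class A ?R (inv_word ?p @ ?p @ ?l) = word_class A ?R ?l" by (rule word_class_eqI)
  then show ?thesis
    using word_norm_class_le[OF l, of ?R] P l
    by (simp add: vertex_element_eq[OF ori sym p] v edge_group_def edge_gens_def word_dist_classes)
qed

text \<open>
  The homomorphism defined by the increments of \<open>\<phi>\<close> vanishes on loops and takes the value
  \<open>\<phi> v - \<phi> u\<close> on the quotient of the two elements.
\<close>

lemma word_dist_vertex_element_ge:
  assumes ori: "orientation G A" and sym: "sym (parcs G)"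
    and p: "pawalk G r p u" and q: "pawalk G r q v"
    and lip: "\<And>x y. (x, y) \<in> parcs G \<Longrightarrow> \<bar>\<phi> y - \<phi> x\<bar> \<le> (1::int)"
  shows "real_of_int (\<phi> v - \<phi> u) \<le> word_dist (edge_group G A) (edge_gens G A)
    (vertex_element G A r u) (vertex_element G A r v)"
proof -
  let ?R = "loop_words G A" and ?p = "map (arc_letter A) p" and ?q = "map (arc_letter A) q"
  let ?h = "\<lambda>e. \<phi> (snd e) - \<phi> (fst e)"
  have P: "?p \<in> words_over A" and Q: "?q \<in> words_over A"
    using p q by (auto simp: pawalk_iff intro!: walk_word_words_over[OF ori])
  have w: "inv_word ?p @ ?q \<in> words_over A" using P Q by (simp add: words_over_rev_inverse)
  have vp: "sum_list (map (letter_value ?h) ?p) = \<phi> u - \<phi> r"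
    and vq: "sum_list (map (letter_value ?h) ?q) = \<phi> v - \<phi> r"
    using p q by (auto simp only: pawalk_iff intro: sum_letter_value_walk)
  have "sum_list (map (letter_value ?h) (inv_word ?p @ ?q)) = \<phi> v - \<phi> u"
    by (simp only: map_append[of "letter_value ?h"] sum_list_append sum_letter_value_inv_word vp vq)
  moreover have "sum_list (map (letter_value ?h) r) = 0" if "r \<in> ?R" for r
    using that sum_letter_value_walk[of _ _ _ \<phi> A]
    by (auto simp only: loop_words_def pawalk_iff mem_Collect_eq diff_self)
  moreover have "\<bar>?h e\<bar> \<le> 1" if "e \<in> A" for e
    using that ori lip by (cases e) (auto simp: orientation_def)
  ultimately have "\<bar>\<phi> v - \<phi> u\<bar> \<le>
      int (word_norm (presented_group A ?R) (presented_gen A ?R ` A) (word_class A ?R (inv_word ?p @ ?q)))"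
    using word_norm_ge_value[of ?R ?h A, OF _ _ w] by metis
  then have "real_of_int (\<phi> v - \<phi> u) \<le>
      word_norm (presented_group A ?R) (presented_gen A ?R ` A) (word_class A ?R (inv_word ?p @ ?q))"
    by linarith
  then show ?thesis
    unfolding vertex_element_eq[OF ori sym p] vertex_element_eq[OF ori sym q]
      edge_group_def edge_gens_def word_dist_classes[OF P Q] .
qed

section \<open>Walks and potentials on a wedge\<close>

abbreviation wedge_class ::
  "'i set \<Rightarrow> ('i \<Rightarrow> 'v pair_pre_digraph) \<Rightarrow> ('i \<Rightarrow> 'v) \<Rightarrow> 'i \<Rightarrow> 'v \<Rightarrow> ('i \<times> 'v) set" where
  "wedge_class I H b i x \<equiv> wedge_rel I H b `` {(i, x)}"

lemma wedge_class_in_verts: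
  "i \<in> I \<Longrightarrow> x \<in> pverts (H i) \<Longrightarrow> wedge_class I H b i x \<in> pverts (wedge I H b)"
  by (auto simp: wedge_def intro!: quotientI)

lemma wedge_class_arc:
  "i \<in> I \<Longrightarrow> (x, y) \<in> parcs (H i) \<Longrightarrow>
    (wedge_class I H b i x, wedge_class I H b i y) \<in> parcs (wedge I H b)"
  by (auto simp: wedge_def)

lemma wedge_arcs_subset:
  assumes "\<And>i. i \<in> I \<Longrightarrow> parcs (H i) \<subseteq> pverts (H i) \<times> pverts (H i)"
  shows "parcs (wedge I H b) \<subseteq> pverts (wedge I H b) \<times> pverts (wedge I H b)"
proof
  fix e assume "e \<in> parcs (wedge I H b)"
  then obtain i x y where "i \<in> I" "(x, y) \<in> parcs (H i)"
    "e = (wedge_class I H b i x, wedge_class I H b i y)" by (auto simp: wedge_def)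
  then show "e \<in> pverts (wedge I H b) \<times> pverts (wedge I H b)"
    using assms[of i] by (auto intro: wedge_class_in_verts)
qed

lemma wedge_sym:
  assumes "\<And>i. i \<in> I \<Longrightarrow> sym (parcs (H i))"
  shows "sym (parcs (wedge I H b))"
proof (rule symI)
  fix C D assume "(C, D) \<in> parcs (wedge I H b)"
  then obtain i x y where i: "i \<in> I" "(x, y) \<in> parcs (H i)" and
    "C = wedge_class I H b i x" "D = wedge_class I H b i y" by (auto simp: wedge_def)
  then show "(D, C) \<in> parcs (wedge I H b)"
    using wedge_class_arc[of i I y x H b] symD[OF assms[OF i(1)] i(2)] by simp
qed

lemma wedge_base_class:
  assumes "\<And>i. i \<in> I \<Longrightarrow> b i \<in> pverts (H i)" "i \<in> I" "j \<in> I"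
  shows "wedge_class I H b i (b i) = wedge_class I H b j (b j)"
  using assms by (intro equiv_class_eq[OF equiv_wedge_rel]) (auto simp: wedge_rel_def)

lemma wedge_rtrancl:
  assumes "i \<in> I" "(x, y) \<in> (parcs (H i))\<^sup>*"
  shows "(wedge_class I H b i x, wedge_class I H b i y) \<in> (parcs (wedge I H b))\<^sup>*"
  using assms(2)
proof induction
  case (step y z)
  then show ?case using wedge_class_arc[of i I y z H b] assms(1) by (meson rtrancl.rtrancl_into_rtrancl)
qed simp

text \<open>
  A function on one of the graphs extends to the wedge by its value at the base vertex on all the
  other graphs; this respects the identification of the base vertices and creates no new
  increments along edges.
\<close>

lemma wedge_potential:
  fixes \<theta> :: "'v \<Rightarrow> int"
  assumes "i \<in> I"
    and wf: "\<And>j. j \<in> I \<Longrightarrow> parcs (H j) \<subseteq> pverts (H j) \<times> pverts (H j)"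
    and lip: "\<And>x y. (x, y) \<in> parcs (H i) \<Longrightarrow> \<bar>\<theta> y - \<theta> x\<bar> \<le> 1"
  obtains \<phi> where
    "\<And>x. x \<in> pverts (H i) \<Longrightarrow> \<phi> (wedge_class I H b i x) = \<theta> x"
    "\<And>C D. (C, D) \<in> parcs (wedge I H b) \<Longrightarrow> \<bar>\<phi> D - \<phi> C\<bar> \<le> 1"
proof -
  define \<psi> where "\<psi> = (\<lambda>(j, x). if j = i then \<theta> x else \<theta> (b i))"
  define \<phi> where "\<phi> C = \<psi> (SOME p. p \<in> C)" for C
  have eq: "\<phi> (wedge_class I H b j x) = \<psi> (j, x)" if "j \<in> I" "x \<in> pverts (H j)" for j x
  proof -
    have "(j, x) \<in> wedge_class I H b j x" using that by (auto simp: wedge_rel_def)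
    then have "(SOME p. p \<in> wedge_class I H b j x) \<in> wedge_class I H b j x" by (rule someI)
    then have "((j, x), SOME p. p \<in> wedge_class I H b j x) \<in> wedge_rel I H b" by simp
    moreover have "\<psi> p = \<psi> (j, x)" if "((j, x), p) \<in> wedge_rel I H b" for p
      using that by (auto simp: wedge_rel_def \<psi>_def)
    ultimately show ?thesis unfolding \<phi>_def by blast
  qed
  show thesis
  proof (rule that[of \<phi>])
    show "\<phi> (wedge_class I H b i x) = \<theta> x" if "x \<in> pverts (H i)" for x
      using eq[OF assms(1) that] by (simp add: \<psi>_def)
    fix C D assume "(C, D) \<in> parcs (wedge I H b)"
    then obtain j x y where j: "j \<in> I" and xy: "(x, y) \<in> parcs (H j)"
      and C: "C = wedge_class I H b j x" and D: "D = wedge_class I H b j y"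
      by (auto simp: wedge_def)
    have "x \<in> pverts (H j)" "y \<in> pverts (H j)" using wf[OF j] xy by auto
    then have "\<phi> C = \<psi> (j, x)" "\<phi> D = \<psi> (j, y)" using eq[OF j] C D by auto
    then show "\<bar>\<phi> D - \<phi> C\<bar> \<le> 1" using lip xy by (auto simp: \<psi>_def)
  qed
qed

section \<open>The torus graphs\<close>

lemma torus_graph_wf: "parcs (torus_graph n) \<subseteq> pverts (torus_graph n) \<times> pverts (torus_graph n)"
  by (auto simp: torus_graph_def)

lemma torus_graph_sym: "sym (parcs (torus_graph n))"
  by (auto simp: torus_graph_def sym_def torus_dist_def cyc_dist_def abs_minus_commute)

lemma cyc_dist_commute: "cyc_dist n x y = cyc_dist n y x"
  by (simp add: cyc_dist_def abs_minus_commute)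

lemma cyc_dist_triangle:
  assumes "x \<in> cyc_points n" "y \<in> cyc_points n" "z \<in> cyc_points n"
  shows "cyc_dist n x z \<le> cyc_dist n x y + cyc_dist n y z"
proof -
  define M :: int where "M = 2 ^ (n + 1)"
  have box: "0 \<le> x" "0 \<le> y" "0 \<le> z" "x < M" "y < M" "z < M"
    using assms by (auto simp: cyc_points_def M_def)
  have le: "cyc_dist n x z \<le> \<bar>x - z\<bar>" "cyc_dist n x z \<le> M - \<bar>x - z\<bar>"
    by (auto simp: cyc_dist_def M_def)
  have "cyc_dist n x y = \<bar>x - y\<bar> \<or> cyc_dist n x y = M - \<bar>x - y\<bar>"
    "cyc_dist n y z = \<bar>y - z\<bar> \<or> cyc_dist n y z = M - \<bar>y - z\<bar>"
    by (auto simp: cyc_dist_def M_def min_def)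
  then show ?thesis using le box by (elim disjE) linarith+
qed

lemma cyc_dist_le_torus_dist: "i < 2 * n ^ n \<Longrightarrow> cyc_dist n (a i) (b i) \<le> torus_dist n a b"
  unfolding torus_dist_def by (intro Max_ge) auto

text \<open>
  A coordinate distance is bounded by the maximum, and that maximum is 1 on an edge. The maximal
  coordinate of two points thus provides a potential that realises their distance.
\<close>

lemma torus_coordinate_lipschitz:
  assumes "i < 2 * n ^ n" "u \<in> torus_points n" "(x, y) \<in> parcs (torus_graph n)"
  shows "\<bar>cyc_dist n (u i) (y i) - cyc_dist n (u i) (x i)\<bar> \<le> 1"
proof -
  have "x \<in> torus_points n" "y \<in> torus_points n" "torus_dist n x y = 1"
    using assms(3) by (auto simp: torus_graph_def)
  then show ?thesis
    using cyc_dist_triangle[of "u i" n "x i" "y i"] cyc_dist_triangle[of "u i" n "y i" "x i"]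
      cyc_dist_le_torus_dist[OF assms(1), of x y] cyc_dist_commute[of n "x i" "y i"] assms(1,2)
    by (force simp: torus_points_def)
qed

text \<open>
  Moving every coordinate of \<open>x\<close> one step towards that of \<open>y\<close> is an edge, and it lowers the maximal
  difference of coordinates. The moves stay between \<open>x\<close> and \<open>y\<close> and never wrap around.
\<close>

lemma torus_graph_connected:
  assumes "x \<in> torus_points n" "y \<in> torus_points n" "\<forall>i<2 * n ^ n. \<bar>x i - y i\<bar> \<le> int k"
  shows "(x, y) \<in> (parcs (torus_graph n))\<^sup>*"
  using assms(1,3)
proof (induction k arbitrary: x)
  case 0
  then have "x = y" using assms(2) by (intro PiE_ext[of x]) (auto simp: torus_points_def)
  then show ?case by simp
next
  case (Suc k)
  show ?case
  proof (cases "x = y")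
    case False
    let ?N = "2 * n ^ n"
    define z where "z = (\<lambda>i\<in>{..<?N}. x i + sgn (y i - x i))"
    obtain j where j: "j < ?N" "x j \<noteq> y j"
      using False PiE_ext[OF Suc.prems(1)[unfolded torus_points_def] assms(2)[unfolded torus_points_def]] by auto
    have box: "x i \<in> cyc_points n" "y i \<in> cyc_points n" if "i < ?N" for i
      using that Suc.prems(1) assms(2) by (auto simp: torus_points_def)
    have "x i + sgn (y i - x i) \<in> cyc_points n" if "i < ?N" for i
      using box[OF that] by (auto simp: cyc_points_def sgn_if)
    then have z: "z \<in> torus_points n" by (auto simp: z_def torus_points_def)
    have "(2::int) ^ (n + 1) \<ge> 2" by simp
    then have step: "cyc_dist n (x i) (z i) = (if x i = y i then 0 else 1)" if "i < ?N" for i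
      using that by (auto simp: cyc_dist_def z_def sgn_if)
    have "torus_dist n x z = 1"
      unfolding torus_dist_def using j step by (intro Max_eqI) (auto simp: image_iff)
    then have "(x, z) \<in> parcs (torus_graph n)" using Suc.prems(1) z by (simp add: torus_graph_def)
    moreover have "\<bar>z i - y i\<bar> \<le> int k" if "i < ?N" for i
      using Suc.prems(2)[rule_format, OF that] that by (auto simp: z_def sgn_if)
    then have "(z, y) \<in> (parcs (torus_graph n))\<^sup>*" using Suc.IH[OF z] by simp
    ultimately show ?thesis by (rule converse_rtrancl_into_rtrancl)
  qed simp
qed

section \<open>Tori inside the edge group\<close>

lemma wedge_torus_walk:
  assumes base: "\<And>n. n \<ge> 1 \<Longrightarrow> b n \<in> torus_points n" and "n \<ge> 1" "x \<in> torus_points n"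
  shows "\<exists>p. pawalk (torus_wedge b) (wedge_class {1..} torus_graph b 1 (b 1)) p
    (wedge_class {1..} torus_graph b n x)"
proof (rule rtrancl_imp_pawalk)
  let ?c = "wedge_class {1..} torus_graph b"
  have verts: "b j \<in> pverts (torus_graph j)" if "j \<in> {1..}" for j
    using base that by (simp add: torus_graph_def)
  let ?d = "Max ((\<lambda>i. nat \<bar>b n i - x i\<bar>) ` {..<2 * n ^ n})"
  have "nat \<bar>b n i - x i\<bar> \<le> ?d" if "i < 2 * n ^ n" for i
    using that by (intro Max_ge) auto
  then have "(b n, x) \<in> (parcs (torus_graph n))\<^sup>*"
    using assms by (intro torus_graph_connected[of _ _ _ ?d]) (auto simp: nat_le_iff)
  then have "(?c n (b n), ?c n x) \<in> (parcs (torus_wedge b))\<^sup>*"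
    using assms(2) by (intro wedge_rtrancl) auto
  moreover have "?c n (b n) = ?c 1 (b 1)"
    using verts assms(2) by (intro wedge_base_class) auto
  ultimately show "(?c 1 (b 1), ?c n x) \<in> (parcs (torus_wedge b))\<^sup>*" by simp
  show "?c n x \<in> pverts (torus_wedge b)"
    using assms by (intro wedge_class_in_verts) (auto simp: torus_graph_def)
  show "parcs (torus_wedge b) \<subseteq> pverts (torus_wedge b) \<times> pverts (torus_wedge b)"
    by (intro wedge_arcs_subset torus_graph_wf)
qed

text \<open>
  The vertex elements restricted to one torus. The bounds say that the embedding is isometric on
  edges and contracts no distance; this is all that the distortion estimate uses.
\<close>

lemma torus_embeds_in_edge_group:
  assumes base: "\<And>n. n \<ge> 1 \<Longrightarrow> b n \<in> torus_points n"
    and ori: "orientation (torus_wedge b) A" and n: "n \<ge> 1"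
  obtains F where
    "\<And>x. x \<in> torus_points n \<Longrightarrow> F x \<in> carrier (edge_group (torus_wedge b) A)"
    "\<And>x y. \<lbrakk>x \<in> torus_points n; y \<in> torus_points n; torus_dist n x y = 1\<rbrakk> \<Longrightarrow>
      word_dist (edge_group (torus_wedge b) A) (edge_gens (torus_wedge b) A) (F x) (F y) \<le> 1"
    "\<And>x y. \<lbrakk>x \<in> torus_points n; y \<in> torus_points n\<rbrakk> \<Longrightarrow> torus_dist n x y \<le>
      word_dist (edge_group (torus_wedge b) A) (edge_gens (torus_wedge b) A) (F x) (F y)"
proof -
  let ?G = "torus_wedge b" and ?c = "wedge_class {1..} torus_graph b"
  define F where "F x = vertex_element ?G A (?c 1 (b 1)) (?c n x)" for x
  have sym: "sym (parcs ?G)" by (intro wedge_sym torus_graph_sym)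
  have walk: "\<exists>p. pawalk ?G (?c 1 (b 1)) p (?c n x)" if "x \<in> torus_points n" for x
    by (rule wedge_torus_walk[OF base n that])
  show thesis
  proof (rule that[of F])
    fix x assume "x \<in> torus_points n"
    then obtain p where "pawalk ?G (?c 1 (b 1)) p (?c n x)" using walk by blast
    then show "F x \<in> carrier (edge_group ?G A)"
      unfolding F_def by (rule vertex_element_carrier[OF ori sym])
  next
    fix x y assume xy: "x \<in> torus_points n" "y \<in> torus_points n"
    obtain p q where p: "pawalk ?G (?c 1 (b 1)) p (?c n x)"
      and q: "pawalk ?G (?c 1 (b 1)) q (?c n y)"
      using walk xy by blast
    show "word_dist (edge_group ?G A) (edge_gens ?G A) (F x) (F y) \<le> 1" if "torus_dist n x y = 1"
      unfolding F_def
    proof (rule word_dist_vertex_element_arc[OF ori sym p])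
      show "(?c n x, ?c n y) \<in> parcs ?G"
        using xy that n by (intro wedge_class_arc) (auto simp: torus_graph_def)
    qed
    have "0 < 2 * n ^ n" using n by simp
    then have "{..<2 * n ^ n} \<noteq> {}" by (metis empty_iff lessThan_iff)
    then have "torus_dist n x y \<in> (\<lambda>i. cyc_dist n (x i) (y i)) ` {..<2 * n ^ n}"
      unfolding torus_dist_def by (intro Max_in) auto
    then obtain i where i: "i < 2 * n ^ n" "torus_dist n x y = cyc_dist n (x i) (y i)" by auto
    have "n \<in> {1..}" using n by simp
    moreover have "\<bar>cyc_dist n (x i) (w i) - cyc_dist n (x i) (z i)\<bar> \<le> 1"
      if "(z, w) \<in> parcs (torus_graph n)" for z w
      using that by (rule torus_coordinate_lipschitz[OF i(1) xy(1)])
    ultimately obtain \<phi> where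
      \<phi>: "\<And>z. z \<in> pverts (torus_graph n) \<Longrightarrow> \<phi> (?c n z) = cyc_dist n (x i) (z i)"
      and lip: "\<And>C D. (C, D) \<in> parcs ?G \<Longrightarrow> \<bar>\<phi> D - \<phi> C\<bar> \<le> 1"
      using torus_graph_wf
        wedge_potential[of n "{1..}" torus_graph "\<lambda>z. cyc_dist n (x i) (z i)" b] by blast
    have "cyc_dist n (x i) (x i) = 0" by (simp add: cyc_dist_def)
    then have diff: "\<phi> (?c n y) - \<phi> (?c n x) = torus_dist n x y"
      using \<phi>[of x] \<phi>[of y] xy i(2) by (simp add: torus_graph_def)
    have "real_of_int (\<phi> (?c n y) - \<phi> (?c n x))
        \<le> word_dist (edge_group ?G A) (edge_gens ?G A) (F x) (F y)"
      unfolding F_def by (rule word_dist_vertex_element_ge[OF ori sym p q]) (rule lip)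
    then show "torus_dist n x y \<le> word_dist (edge_group ?G A) (edge_gens ?G A) (F x) (F y)"
      by (simp only: diff)
  qed
qed

theorem theorem3:
  fixes b :: "nat \<Rightarrow> nat \<Rightarrow> int"
    and A :: "(nat \<times> (nat \<Rightarrow> int)) set rel"
  assumes base: "\<And>n. n \<ge> 1 \<Longrightarrow> b n \<in> pverts (torus_graph n)"
    and ori: "orientation (torus_wedge b) A"
  shows "\<not> (\<exists>f :: _ \<Rightarrow> 'h :: {real_inner, complete_space}.
            coarsely_uniform_embedding
              (carrier (edge_group (torus_wedge b) A))
              (word_dist (edge_group (torus_wedge b) A) (edge_gens (torus_wedge b) A))
              (UNIV :: 'h set) dist f)"
proof
  let ?\<Gamma> = "edge_group (torus_wedge b) A"
  let ?d = "word_dist ?\<Gamma> (edge_gens (torus_wedge b) A)"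
  assume "\<exists>f :: _ \<Rightarrow> 'h. coarsely_uniform_embedding (carrier ?\<Gamma>) ?d (UNIV :: 'h set) dist f"
  then obtain f :: "_ \<Rightarrow> 'h" and \<rho>1 \<rho>2 :: "real \<Rightarrow> real" where
    nonneg: "\<forall>t\<ge>0. \<rho>1 t \<ge> 0 \<and> \<rho>2 t \<ge> 0" and lim: "filterlim \<rho>1 at_top at_top"
    and f: "\<forall>x\<in>carrier ?\<Gamma>. \<forall>y\<in>carrier ?\<Gamma>.
      \<rho>1 (?d x y) \<le> dist (f x) (f y) \<and> dist (f x) (f y) \<le> \<rho>2 (?d x y)"
    unfolding coarsely_uniform_embedding_def by blast
  define C where "C = max (\<rho>2 0) (\<rho>2 1)"
  have "C \<ge> 0" using nonneg by (simp add: C_def max_def)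
  obtain T where T: "\<And>t. t \<ge> T \<Longrightarrow> 3 * C + 1 \<le> \<rho>1 t"
    using lim unfolding filterlim_at_top eventually_at_top_linorder by blast
  \<comment> \<open>A scale beyond the threshold of the lower control function; the distortion bound needs \<open>n \<ge> 2\<close>.\<close>
  obtain m where "T \<le> 2 ^ m" using real_arch_pow[of 2 T] by (auto intro: less_imp_le)
  also have "(2::real) ^ m \<le> 2 ^ max m 2" by (intro power_increasing) auto
  finally obtain n where n: "n \<ge> 2" "T \<le> 2 ^ n" by (metis max.cobounded2)
  have "b j \<in> torus_points j" if "j \<ge> 1" for j using base[OF that] by (simp add: torus_graph_def)
  moreover have "n \<ge> 1" using n by simp
  ultimately obtain F where F: "\<And>x. x \<in> torus_points n \<Longrightarrow> F x \<in> carrier ?\<Gamma>"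
    and short: "\<And>x y. \<lbrakk>x \<in> torus_points n; y \<in> torus_points n; torus_dist n x y = 1\<rbrakk>
      \<Longrightarrow> ?d (F x) (F y) \<le> 1"
    and long: "\<And>x y. \<lbrakk>x \<in> torus_points n; y \<in> torus_points n\<rbrakk>
      \<Longrightarrow> torus_dist n x y \<le> ?d (F x) (F y)"
    using torus_embeds_in_edge_group[OF _ ori] by metis
  \<comment> \<open>Adjacent points have group distance 0 or 1, so \<open>C\<close> bounds their images; points at distance
    \<open>2\<^bsup>n\<^esup>\<close> are mapped too far apart for the distortion bound.\<close>
  have "3 * C + 1 \<le> 3 * C"
  proof (rule hilbert_torus_distortion[OF n(1), where g = "\<lambda>x. f (F x)"])
    show "0 \<le> 3 * C + 1" using \<open>C \<ge> 0\<close> by simp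
    fix x y assume xy: "x \<in> torus_points n" "y \<in> torus_points n"
    show "dist (f (F x)) (f (F y)) \<le> C" if "torus_dist n x y = 1"
    proof -
      have "?d (F x) (F y) = 0 \<or> ?d (F x) (F y) = 1"
        using short[OF xy that] unfolding word_dist_def by auto
      then have "\<rho>2 (?d (F x) (F y)) \<le> C" by (auto simp: C_def)
      then show ?thesis using f F xy by (meson order_trans)
    qed
    show "3 * C + 1 \<le> dist (f (F x)) (f (F y))" if "torus_dist n x y = 2 ^ n"
    proof -
      have "T \<le> ?d (F x) (F y)" using long[OF xy] n(2) that by simp
      then show ?thesis using T f F xy by (meson order_trans)
    qed
  qed
  then show False by simp
qed

end
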